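(* For every integer $r\ge 2$ there exist a finite family $\mathcal{F}$ of $r$-graphs and a constant $k\in\mathbb{N}$ such that $$\operatorname{sat}(\mathcal{F},n)=\begin{cases} O(n) & \text{if } k\mid n,\\ \Omega\left(n^{r-1}\right) & \text{if } k\nmid n.\end{cases}$$ In particular, for any $l\in\{1,2,\ldots,r-1\}$, the sequence $\frac{\operatorname{sat}(\mathcal{F},n)}{n^{l}}$ does not converge as $n\to\infty$.
   Context: An $r$-graph $H$ is a pair $(V(H),E(H))$ where $V(H)$ is a finite set of vertices and the edge set $E(H)$ is a collection of $r$-element subsets of $V(H)$. Write $|H|=|V(H)|$ and $e(H)=|E(H)|$. Containment of one $r$-graph in another as a subgraph means containing a (not necessarily induced) copy of it. For a family $\mathcal{F}$ of $r$-graphs, an $r$-graph $H$ is called $\mathcal{F}$-saturated if it does not contain any graph in $\mathcal{F}$ as a subgraph, but adding any extra edge (that is, any $r$-element subset of $V(H)$ not in $E(H)$) to $H$ creates a copy of some graph $F\in\mathcal{F}$ as a subgraph. The saturation number is $$\operatorname{sat}(\mathcal{F},n)=\min\{e(H): |H|=n \text{ and } H \text{ is } \mathcal{F}\text{-saturated}\}.$$ The notations $O(\cdot)$ and $\Omega(\cdot)$ are asymptotic as $n\to\infty$ along the indicated values of $n$ (multiples of $k$, respectively non-multiples of $k$), with $r$, $k$ and $\mathcal{F}$ fixed. *)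

theory Defs
  imports Complex_Main "HOL-Library.Landau_Symbols"
begin

type_synonym 'a hgraph = "'a set \<times> 'a set set"

abbreviation verts :: "'a hgraph \<Rightarrow> 'a set" where "verts H \<equiv> fst H"
abbreviation edges :: "'a hgraph \<Rightarrow> 'a set set" where "edges H \<equiv> snd H"

definition r_graph :: "nat \<Rightarrow> 'a hgraph \<Rightarrow> bool" where
  "r_graph r H \<longleftrightarrow> finite (verts H) \<and> (\<forall>e\<in>edges H. e \<subseteq> verts H \<and> card e = r)"

text \<open>\<open>contains_copy H G\<close>: \<open>H\<close> contains a, not necessarily induced, copy of \<open>G\<close>.\<close>

definition contains_copy :: "'a hgraph \<Rightarrow> 'b hgraph \<Rightarrow> bool" where
  "contains_copy H G \<longleftrightarrow>
     (\<exists>f. inj_on f (verts G) \<and> f ` verts G \<subseteq> verts H \<and> (\<forall>e\<in>edges G. f ` e \<in> edges H))"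

definition add_edge :: "'a set \<Rightarrow> 'a hgraph \<Rightarrow> 'a hgraph" where
  "add_edge e H = (verts H, insert e (edges H))"

definition saturated :: "nat \<Rightarrow> 'b hgraph set \<Rightarrow> 'a hgraph \<Rightarrow> bool" where
  "saturated r \<F> H \<longleftrightarrow>
     r_graph r H \<and>
     (\<forall>G\<in>\<F>. \<not> contains_copy H G) \<and>
     (\<forall>e. e \<subseteq> verts H \<and> card e = r \<and> e \<notin> edges H \<longrightarrow>
        (\<exists>G\<in>\<F>. contains_copy (add_edge e H) G))"

text \<open>
  Every finite \<open>r\<close>-graph is isomorphic to one whose vertices are natural numbers, so it suffices
  to let \<open>H\<close> range over these. On \<^typ>\<open>nat\<close> the infimum of a nonempty set is its minimum.
  The set below can only be empty if some member of \<open>\<F>\<close> is edgeless, and it is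
  then empty for all large \<open>n\<close>.
\<close>

definition sat_number :: "nat \<Rightarrow> 'b hgraph set \<Rightarrow> nat \<Rightarrow> nat" where
  "sat_number r \<F> n =
     Inf {card (edges H) | H :: nat hgraph. card (verts H) = n \<and> saturated r \<F> H}"

end

theory Submission
  imports Defs
begin

text \<open>
  Fix \<open>k > r\<close>. Let \<open>\<F>\<close> consist of the \<open>r\<close>-graphs with at most \<open>r * k\<close> vertices in which every vertex
  lies in a complete subgraph on \<open>k\<close> vertices (a \<open>k\<close>-clique), and in which some edge meets a
  \<open>k\<close>-clique without being contained in it.

  A disjoint union of \<open>k\<close>-cliques is \<open>\<F>\<close>-saturated: its only \<open>k\<close>-cliques are the components, so no
  edge crosses one, whereas a new edge \<open>e\<close> crosses the at most \<open>r\<close> components that it meets, and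
  these components together with \<open>e\<close> form a member of \<open>\<F>\<close>. Hence the saturation number is at most
  \<open>(n / k) * (k choose r)\<close> when \<open>k\<close> divides \<open>n\<close> (\<open>sat_number_multiple\<close>).

  Conversely, in an \<open>\<F>\<close>-free graph distinct \<open>k\<close>-cliques are disjoint. So if \<open>k\<close> does not divide
  the number of vertices of a saturated graph, some vertex \<open>v\<close> lies in no \<open>k\<close>-clique
  (\<open>uncovered_vertex\<close>). Since all vertices of a member of \<open>\<F>\<close> lie in \<open>k\<close>-cliques, adding a missing
  edge \<open>e\<close> through \<open>v\<close> must complete a \<open>k\<close>-clique containing \<open>e\<close> (\<open>completes_clique\<close>). As \<open>k > r\<close>, every
  \<open>(r - 1)\<close>-subset of \<open>e\<close> then lies in an edge already present. Every \<open>(r - 1)\<close>-set of vertices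
  extends to an \<open>r\<close>-set through \<open>v\<close>, so all of them are covered by edges (\<open>shadow_full\<close>), and there
  are at least \<open>(n choose (r - 1)) / r\<close> edges.

  For \<open>r \<ge> 3\<close> these bounds already preclude convergence. For \<open>r = 2\<close> both orders of magnitude are
  linear and the constants must be compared. Take \<open>k = 4\<close>: multiples of \<open>4\<close> give at most
  \<open>(3 / 2) * n\<close> edges. For the other \<open>n\<close>, if some \<open>v\<close> in no \<open>k\<close>-clique has degree less than \<open>k\<close>, each of its
  non-neighbours has \<open>k - 2\<close> edges into the small neighbourhood of \<open>v\<close>, which gives at least
  \<open>(k - 2) * (n - k)\<close> edges (\<open>graph_edges_lower_small_degree\<close>). Otherwise all degrees are at least
  \<open>k - 1\<close> and a proportion of at least \<open>1 / k\<close> of the vertices has degree at least \<open>k\<close>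
  (\<open>graph_edges_lower_large_degree\<close>). For \<open>k = 4\<close> and large \<open>n\<close> both cases give at least
  \<open>(13 / 8) * n\<close> edges.
\<close>

section \<open>The forbidden family\<close>

text \<open>The vertex sets of the complete \<open>r\<close>-graphs on \<open>k\<close> vertices contained in \<open>H\<close>.\<close>

definition cliques :: "nat \<Rightarrow> nat \<Rightarrow> 'a hgraph \<Rightarrow> 'a set set" where
  "cliques r k H = {K. K \<subseteq> verts H \<and> card K = k \<and> (\<forall>g. g \<subseteq> K \<and> card g = r \<longrightarrow> g \<in> edges H)}"

text \<open>
  \<open>U\<close> is covered by \<open>k\<close>-cliques inside \<open>U\<close>, and some edge inside \<open>U\<close> crosses the boundary of one of
  these cliques.
\<close>

definition clash :: "nat \<Rightarrow> nat \<Rightarrow> 'a hgraph \<Rightarrow> 'a set \<Rightarrow> bool" where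
  "clash r k H U \<longleftrightarrow> U \<subseteq> verts H \<and> (\<forall>x\<in>U. \<exists>K\<in>cliques r k H. K \<subseteq> U \<and> x \<in> K) \<and>
     (\<exists>K\<in>cliques r k H. \<exists>g\<in>edges H. K \<subseteq> U \<and> g \<subseteq> U \<and> g \<inter> K \<noteq> {} \<and> \<not> g \<subseteq> K)"

text \<open>
  No set of at most \<open>r * k\<close> vertices carries a clash. In an \<open>r\<close>-graph the value \<open>0\<close> of \<open>card\<close> on infinite
  sets is harmless, because a clash lies inside the finite vertex set.
\<close>

definition clash_free :: "nat \<Rightarrow> nat \<Rightarrow> 'a hgraph \<Rightarrow> bool" where
  "clash_free r k H \<longleftrightarrow> (\<forall>U. card U \<le> r * k \<longrightarrow> \<not> clash r k H U)"

text \<open>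
  The family \<open>\<F>\<close>: all labelled \<open>r\<close>-graphs, on vertices below \<open>r * k\<close>, whose whole vertex set is a
  clash.
\<close>

definition clash_family :: "nat \<Rightarrow> nat \<Rightarrow> nat hgraph set" where
  "clash_family r k = {G. r_graph r G \<and> verts G \<subseteq> {..<r * k} \<and> clash r k G (verts G)}"

lemma finite_clash_family: "finite (clash_family r k)"
proof (rule finite_subset)
  show "clash_family r k \<subseteq> Pow {..<r * k} \<times> Pow (Pow {..<r * k})"
    unfolding clash_family_def r_graph_def by fastforce
qed simp

lemma r_graph_add_edge:
  "r_graph r H \<Longrightarrow> e \<subseteq> verts H \<Longrightarrow> card e = r \<Longrightarrow> r_graph r (add_edge e H)"
  by (auto simp: r_graph_def add_edge_def)

lemma finite_edges: "r_graph r H \<Longrightarrow> finite (edges H)"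
  by (rule finite_subset[of _ "Pow (verts H)"]) (auto simp: r_graph_def)

lemma finite_clique: "r_graph r H \<Longrightarrow> K \<in> cliques r k H \<Longrightarrow> finite K"
  by (auto simp: r_graph_def cliques_def intro: finite_subset)

lemma clash_image:
  assumes inj: "inj_on f (verts G)" and sub: "f ` verts G \<subseteq> verts H"
    and hom: "\<forall>e\<in>edges G. f ` e \<in> edges H"
    and G: "clash r k G (verts G)"
  shows "clash r k H (f ` verts G)"
proof -
  have im: "f ` K \<in> cliques r k H" if K: "K \<in> cliques r k G" for K
  proof -
    have KG: "K \<subseteq> verts G" and cK: "card K = k" using K by (auto simp: cliques_def)
    have injK: "inj_on f K" using inj KG by (rule inj_on_subset)
    have "g \<in> edges H" if g: "g \<subseteq> f ` K" "card g = r" for g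
    proof -
      obtain g' where g': "g' \<subseteq> K" "g = f ` g'" using g(1) by (auto simp: subset_image_iff)
      have "card g' = r" using g g' injK by (metis card_image inj_on_subset)
      then show ?thesis using K g' hom by (auto simp: cliques_def)
    qed
    then show ?thesis using KG cK sub injK by (auto simp: cliques_def card_image)
  qed
  obtain K g where Kg: "K \<in> cliques r k G" "g \<in> edges G" "K \<subseteq> verts G" "g \<subseteq> verts G"
      "g \<inter> K \<noteq> {}" "\<not> g \<subseteq> K"
    using G unfolding clash_def by blast
  have out: "\<not> f ` g \<subseteq> f ` K"
  proof -
    obtain y where y: "y \<in> g" "y \<notin> K" using Kg by blast
    then have "f y \<notin> f ` K" using inj_on_image_mem_iff[OF inj _ Kg(3), of y] Kg(4) by blast
    then show ?thesis using y by blast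
  qed
  have "f ` g \<inter> f ` K \<noteq> {}" using Kg by blast
  then have cross: "\<exists>K\<in>cliques r k H. \<exists>g\<in>edges H.
      K \<subseteq> f ` verts G \<and> g \<subseteq> f ` verts G \<and> g \<inter> K \<noteq> {} \<and> \<not> g \<subseteq> K"
    using im[OF Kg(1)] bspec[OF hom Kg(2)] image_mono[OF Kg(3), of f] image_mono[OF Kg(4), of f] out
    by meson
  have cover: "\<exists>K\<in>cliques r k H. K \<subseteq> f ` verts G \<and> x \<in> K" if x: "x \<in> f ` verts G" for x
  proof -
    obtain y where y: "y \<in> verts G" "x = f y" using x by blast
    obtain L where L: "L \<in> cliques r k G" "L \<subseteq> verts G" "y \<in> L"
      using G y unfolding clash_def by blast
    show ?thesis
      by (rule bexI[OF _ im[OF L(1)]]) (use L y in auto)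
  qed
  show ?thesis unfolding clash_def by (intro conjI ballI sub cross cover)
qed

text \<open>
  Avoiding the family is an intrinsic property of \<open>H\<close>: an embedded member is a clash on its image,
  and a clash on a set \<open>U\<close> induces a graph that can be relabelled to a member.
\<close>

lemma clash_free_iff:
  assumes H: "r_graph r H"
  shows "clash_free r k H \<longleftrightarrow> (\<forall>G\<in>clash_family r k. \<not> contains_copy H G)"
proof
  assume free: "clash_free r k H"
  show "\<forall>G\<in>clash_family r k. \<not> contains_copy H G"
  proof (intro ballI notI)
    fix G assume G: "G \<in> clash_family r k" and "contains_copy H G"
    then obtain f where f: "inj_on f (verts G)" "f ` verts G \<subseteq> verts H"
        "\<forall>e\<in>edges G. f ` e \<in> edges H"
      unfolding contains_copy_def by blast
    have "clash r k H (f ` verts G)"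
      using G by (intro clash_image f) (auto simp: clash_family_def)
    moreover have "card (f ` verts G) \<le> r * k"
    proof -
      have "card (verts G) \<le> card {..<r * k}"
        using G by (intro card_mono) (auto simp: clash_family_def)
      then show ?thesis using f(1) by (simp add: card_image)
    qed
    ultimately show False using free by (auto simp: clash_free_def)
  qed
next
  assume no: "\<forall>G\<in>clash_family r k. \<not> contains_copy H G"
  show "clash_free r k H"
    unfolding clash_free_def
  proof (intro allI impI notI)
    fix U assume cU: "card U \<le> r * k" and U: "clash r k H U"
    have UV: "U \<subseteq> verts H" using U by (simp add: clash_def)
    have finU: "finite U" using UV H finite_subset by (auto simp: r_graph_def)
    obtain h where h: "bij_betw h U {..<card U}"
      using finU ex_bij_betw_finite_nat[of U] by (auto simp: atLeast0LessThan)
    have injh: "inj_on h U" and imh: "h ` U = {..<card U}" using h by (auto simp: bij_betw_def)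
    define I where "I = (U, {g \<in> edges H. g \<subseteq> U})"
    define G where "G = (h ` U, (\<lambda>g. h ` g) ` {g \<in> edges H. g \<subseteq> U})"
    have cI: "K \<in> cliques r k I \<longleftrightarrow> K \<in> cliques r k H \<and> K \<subseteq> U" for K
      using UV by (auto simp: cliques_def I_def)
    have "clash r k I (verts I)"
    proof -
      obtain K g where "K \<in> cliques r k H" "g \<in> edges H" "K \<subseteq> U" "g \<subseteq> U" "g \<inter> K \<noteq> {}" "\<not> g \<subseteq> K"
        using U unfolding clash_def by blast
      then have "\<exists>K\<in>cliques r k I. \<exists>g\<in>edges I. K \<subseteq> U \<and> g \<subseteq> U \<and> g \<inter> K \<noteq> {} \<and> \<not> g \<subseteq> K"
        using cI by (intro bexI[of _ K] bexI[of _ g]) (auto simp: I_def)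
      moreover have "\<forall>x\<in>U. \<exists>K\<in>cliques r k I. K \<subseteq> U \<and> x \<in> K"
        using U cI unfolding clash_def by blast
      moreover have "verts I = U" by (simp add: I_def)
      ultimately show ?thesis unfolding clash_def by simp
    qed
    moreover have "clash r k G (h ` verts I)"
      by (rule clash_image[of h I G r k]) (use injh calculation in \<open>auto simp: I_def G_def\<close>)
    moreover have "r_graph r G"
      unfolding r_graph_def
    proof (intro conjI ballI)
      show "finite (verts G)" using finU by (simp add: G_def)
      fix e assume "e \<in> edges G"
      then obtain g where g: "g \<in> edges H" "g \<subseteq> U" "e = h ` g" by (auto simp: G_def)
      show "e \<subseteq> verts G" using g by (auto simp: G_def)
      show "card e = r" using g H inj_on_subset[OF injh g(2)] by (simp add: card_image r_graph_def)
    qed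
    ultimately have "G \<in> clash_family r k"
      using cU imh by (auto simp: clash_family_def I_def G_def)
    moreover have "contains_copy H G"
      unfolding contains_copy_def
    proof (intro exI conjI ballI)
      show "inj_on (inv_into U h) (verts G)"
        by (simp add: G_def inj_on_inv_into)
      show "inv_into U h ` verts G \<subseteq> verts H" using UV injh by (auto simp: G_def)
      fix e assume "e \<in> edges G"
      then obtain g where g: "g \<in> edges H" "g \<subseteq> U" "e = h ` g" by (auto simp: G_def)
      then show "inv_into U h ` e \<in> edges H" using injh by (simp add: inv_into_image_cancel)
    qed
    ultimately show False using no by blast
  qed
qed

lemma saturated_iff:
  "saturated r (clash_family r k) H \<longleftrightarrow> r_graph r H \<and> clash_free r k H \<and>
     (\<forall>e. e \<subseteq> verts H \<and> card e = r \<and> e \<notin> edges H \<longrightarrow> \<not> clash_free r k (add_edge e H))"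
  unfolding saturated_def using clash_free_iff r_graph_add_edge by (metis (no_types, lifting))

lemma clique_edge:
  assumes K: "K \<in> cliques r k H" and "finite K" "x \<in> K" "y \<in> K" "2 \<le> r" "r \<le> k"
  shows "\<exists>g\<in>edges H. g \<subseteq> K \<and> x \<in> g \<and> y \<in> g"
proof -
  have "card {x, y} \<le> r" using assms(5) card_insert_le_m1[of 2 "{y}" x] by simp
  then obtain g where "{x, y} \<subseteq> g" "g \<subseteq> K" "card g = r"
    using exists_subset_between[of "{x, y}" r K] assms by (auto simp: cliques_def)
  then show ?thesis using K by (auto simp: cliques_def)
qed

lemma clique_unique:
  assumes H: "r_graph r H" "clash_free r k H" and r: "2 \<le> r" "r \<le> k"
    and K: "K \<in> cliques r k H" and L: "L \<in> cliques r k H" and x: "x \<in> K" "x \<in> L"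
  shows "K = L"
proof (rule ccontr)
  assume "K \<noteq> L"
  have fin: "finite K" "finite L" using H K L finite_clique by blast+
  have c: "card K = k" "card L = k" using K L by (auto simp: cliques_def)
  then obtain y where y: "y \<in> L" "y \<notin> K"
    using \<open>K \<noteq> L\<close> fin card_subset_eq[of K L] by auto
  obtain g where g: "g \<in> edges H" "g \<subseteq> L" "x \<in> g" "y \<in> g"
    using clique_edge[OF L fin(2) x(2) y(1) r] by blast
  have "clash r k H (K \<union> L)"
    unfolding clash_def
  proof (intro conjI)
    show "K \<union> L \<subseteq> verts H" using K L by (auto simp: cliques_def)
    show "\<forall>x\<in>K \<union> L. \<exists>M\<in>cliques r k H. M \<subseteq> K \<union> L \<and> x \<in> M" using K L by blast
    show "\<exists>M\<in>cliques r k H. \<exists>g\<in>edges H. M \<subseteq> K \<union> L \<and> g \<subseteq> K \<union> L \<and> g \<inter> M \<noteq> {} \<and> \<not> g \<subseteq> M"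
      using K g x y by blast
  qed
  moreover have "card (K \<union> L) \<le> r * k"
  proof -
    have "card (K \<union> L) \<le> 2 * k" using card_Un_le[of K L] c by simp
    also have "\<dots> \<le> r * k" using r by simp
    finally show ?thesis .
  qed
  ultimately show False using H by (auto simp: clash_free_def)
qed

section \<open>Saturated graphs with a vertex in no clique\<close>

lemma dvd_card_if_covered:
  assumes H: "r_graph r H" "clash_free r k H" and r: "2 \<le> r" "r \<le> k"
    and cov: "verts H \<subseteq> \<Union> (cliques r k H)"
  shows "k dvd card (verts H)"
proof -
  have eq: "verts H = \<Union> (cliques r k H)" using cov by (auto simp: cliques_def)
  show ?thesis unfolding eq
  proof (rule dvd_partition)
    show "finite (\<Union> (cliques r k H))" using H eq by (simp add: r_graph_def)
    show "\<forall>c\<in>cliques r k H. k dvd card c" by (auto simp: cliques_def)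
    show "\<forall>c1\<in>cliques r k H. \<forall>c2\<in>cliques r k H. c1 \<noteq> c2 \<longrightarrow> c1 \<inter> c2 = {}"
      using clique_unique[OF H r] by blast
  qed
qed

lemma uncovered_vertex:
  assumes "saturated r (clash_family r k) H" "2 \<le> r" "r \<le> k" "\<not> k dvd card (verts H)"
  obtains v where "v \<in> verts H" "v \<notin> \<Union> (cliques r k H)"
proof -
  have "r_graph r H" "clash_free r k H" using assms(1) unfolding saturated_iff by simp_all
  then have "\<not> verts H \<subseteq> \<Union> (cliques r k H)" using dvd_card_if_covered[of r H k] assms(2-4) by metis
  then show ?thesis using that by (auto simp: subset_iff simp del: Union_iff)
qed

text \<open>
  If the added edge \<open>e\<close> were in no \<open>k\<close>-clique, the \<open>k\<close>-cliques would be those of \<open>H\<close>. None of them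
  contains \<open>v\<close>, so the clash created would avoid \<open>v\<close>, hence not use \<open>e\<close>, and be present in \<open>H\<close>.
\<close>

lemma completes_clique:
  assumes sat: "saturated r (clash_family r k) H"
    and v: "v \<notin> \<Union> (cliques r k H)"
    and e: "e \<subseteq> verts H" "card e = r" "e \<notin> edges H" "v \<in> e"
  obtains K where "K \<in> cliques r k (add_edge e H)" "e \<subseteq> K"
proof -
  have free: "clash_free r k H" and "\<not> clash_free r k (add_edge e H)"
    using sat e unfolding saturated_iff by blast+
  then obtain U where cU: "card U \<le> r * k" and U: "clash r k (add_edge e H) U"
    by (auto simp: clash_free_def)
  have "\<exists>K\<in>cliques r k (add_edge e H). e \<subseteq> K"
  proof (rule ccontr)
    assume no: "\<not> ?thesis"
    have same: "cliques r k (add_edge e H) = cliques r k H"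
    proof
      show "cliques r k (add_edge e H) \<subseteq> cliques r k H"
      proof
        fix K assume K: "K \<in> cliques r k (add_edge e H)"
        then have "\<not> e \<subseteq> K" using no by blast
        with K show "K \<in> cliques r k H" by (auto simp: cliques_def add_edge_def)
      qed
      show "cliques r k H \<subseteq> cliques r k (add_edge e H)" by (auto simp: cliques_def add_edge_def)
    qed
    have "v \<notin> U" using U v unfolding clash_def same by blast
    then have "\<not> e \<subseteq> U" using e by blast
    then have "clash r k H U" using U unfolding clash_def same by (auto simp: add_edge_def)
    then show False using free cU by (auto simp: clash_free_def)
  qed
  then show ?thesis using that by blast
qed

text \<open>
  Extend \<open>S\<close> to an \<open>r\<close>-set \<open>e\<close> through \<open>v\<close>. If \<open>e\<close> is missing, it lies in a clique completed by adding
  \<open>e\<close>; exchanging the new vertex of \<open>e\<close> for a clique vertex outside \<open>e\<close> gives an edge of \<open>H\<close>.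
\<close>

lemma shadow_full:
  assumes sat: "saturated r (clash_family r k) H"
    and v: "v \<in> verts H" "v \<notin> \<Union> (cliques r k H)"
    and r: "1 \<le> r" "r < k" and n: "r \<le> card (verts H)"
    and S: "S \<subseteq> verts H" "card S = r - 1"
  shows "\<exists>g\<in>edges H. S \<subseteq> g"
proof -
  have H: "r_graph r H" using sat by (simp add: saturated_def)
  have fin: "finite (verts H)" using H by (simp add: r_graph_def)
  then have finS: "finite S" using S finite_subset by blast
  obtain u where u: "u \<in> verts H" "u \<notin> S" "v \<in> insert u S"
  proof (cases "v \<in> S")
    case True
    have "S \<noteq> verts H" using S n r by auto
    then show ?thesis using that True S by blast
  qed (use that v in blast)
  define e where "e = insert u S"
  have e: "e \<subseteq> verts H" "card e = r" "v \<in> e" using u S finS r by (auto simp: e_def)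
  show ?thesis
  proof (cases "e \<in> edges H")
    case True
    then show ?thesis by (auto simp: e_def)
  next
    case False
    obtain K where K: "K \<in> cliques r k (add_edge e H)" "e \<subseteq> K"
      using completes_clique[OF sat v(2) e(1,2) False e(3)] .
    have "card K = k" using K by (simp add: cliques_def)
    then have "e \<noteq> K" using e r by auto
    then obtain y where y: "y \<in> K" "y \<notin> e" using K by blast
    then have "card (insert y S) = r" using S finS r by (auto simp: e_def)
    moreover have "insert y S \<subseteq> K" using y K by (auto simp: e_def)
    ultimately have "insert y S \<in> insert e (edges H)"
      using K by (auto simp: cliques_def add_edge_def)
    then have "insert y S \<in> edges H" using y by auto
    then show ?thesis by blast
  qed
qed

lemma card_edges_lower:
  assumes sat: "saturated r (clash_family r k) H"
    and r: "2 \<le> r" "r < k" and n: "r \<le> card (verts H)" "\<not> k dvd card (verts H)"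
  shows "card (verts H) choose (r - 1) \<le> r * card (edges H)"
proof -
  have H: "r_graph r H" using sat by (simp add: saturated_def)
  have fin: "finite (verts H)" using H by (simp add: r_graph_def)
  obtain v where v: "v \<in> verts H" "v \<notin> \<Union> (cliques r k H)"
    using uncovered_vertex[OF sat r(1)] r n by auto
  have fing: "finite g" "card g = r" if "g \<in> edges H" for g
    using H that finite_subset[OF _ fin] by (auto simp: r_graph_def)
  have "card (verts H) choose (r - 1) = card {S. S \<subseteq> verts H \<and> card S = r - 1}"
    using n_subsets[OF fin] by simp
  also have "\<dots> \<le> card (\<Union>g\<in>edges H. {S. S \<subseteq> g \<and> card S = r - 1})"
  proof (rule card_mono)
    show "finite (\<Union>g\<in>edges H. {S. S \<subseteq> g \<and> card S = r - 1})"
      using finite_edges[OF H] fing by auto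
    show "{S. S \<subseteq> verts H \<and> card S = r - 1} \<subseteq> (\<Union>g\<in>edges H. {S. S \<subseteq> g \<and> card S = r - 1})"
      using shadow_full[OF sat v] r n by auto
  qed
  also have "\<dots> \<le> (\<Sum>g\<in>edges H. card {S. S \<subseteq> g \<and> card S = r - 1})"
    by (rule card_UN_le[OF finite_edges[OF H]])
  also have "\<dots> = (\<Sum>g\<in>edges H. r)"
  proof (rule sum.cong[OF refl])
    fix g assume g: "g \<in> edges H"
    have "r choose (r - 1) = r" using r binomial_symmetric[of 1 r] by simp
    then show "card {S. S \<subseteq> g \<and> card S = r - 1} = r" using n_subsets[of g "r - 1"] fing[OF g] by simp
  qed
  finally show ?thesis by (simp add: mult.commute)
qed

section \<open>Disjoint unions of cliques\<close>

text \<open>The \<open>j\<close>-th interval of \<open>k\<close> consecutive natural numbers, counted from \<open>0\<close>.\<close>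

definition block :: "nat \<Rightarrow> nat \<Rightarrow> nat set" where
  "block k j = {j * k..<j * k + k}"

text \<open>The disjoint union of \<open>m\<close> complete \<open>r\<close>-graphs, one on each of the first \<open>m\<close> blocks.\<close>

definition clique_union :: "nat \<Rightarrow> nat \<Rightarrow> nat \<Rightarrow> nat hgraph" where
  "clique_union r k m = ({..<m * k}, {g. card g = r \<and> (\<exists>j<m. g \<subseteq> block k j)})"

lemma card_block [simp]: "card (block k j) = k" and finite_block [simp]: "finite (block k j)"
  by (auto simp: block_def)

lemma mem_block: "0 < k \<Longrightarrow> x \<in> block k j \<longleftrightarrow> x div k = j"
  unfolding block_def by (auto simp: div_nat_eqI mult.commute dividend_less_times_div)
    (metis add.commute mult.commute mult_Suc_right dividend_less_times_div)

lemma block_subset: "j < m \<Longrightarrow> block k j \<subseteq> {..<m * k}"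
proof -
  assume "j < m"
  then have "Suc j * k \<le> m * k" by (intro mult_le_mono1) simp
  then show ?thesis by (auto simp: block_def)
qed

lemma cliques_clique_union:
  assumes r: "2 \<le> r" "r \<le> k" and K: "K \<in> cliques r k (clique_union r k m)"
  shows "\<exists>j<m. K = block k j"
proof -
  have cK: "card K = k" and KV: "K \<subseteq> {..<m * k}" using K by (auto simp: cliques_def clique_union_def)
  have finK: "finite K" using KV finite_subset by blast
  have "K \<noteq> {}" using cK r by auto
  then obtain x where x: "x \<in> K" by blast
  have "K \<subseteq> block k (x div k)"
  proof
    fix y assume "y \<in> K"
    then obtain g where "g \<in> edges (clique_union r k m)" "x \<in> g" "y \<in> g"
      using clique_edge[OF K finK x _ r] by blast
    then obtain j where "x \<in> block k j" "y \<in> block k j" by (auto simp: clique_union_def)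
    then show "y \<in> block k (x div k)" using r by (simp add: mem_block)
  qed
  then have "K = block k (x div k)" using card_subset_eq[of "block k (x div k)" K] cK by simp
  moreover have "x div k < m" using x KV by (auto simp: less_mult_imp_div_less)
  ultimately show ?thesis by blast
qed

lemma saturated_clique_union:
  assumes r: "2 \<le> r" "r \<le> k"
  shows "saturated r (clash_family r k) (clique_union r k m)" (is "saturated r _ ?H")
  unfolding saturated_iff
proof (intro conjI allI impI)
  show H: "r_graph r ?H"
    using block_subset by (fastforce simp: r_graph_def clique_union_def)
  show "clash_free r k ?H"
    unfolding clash_free_def
  proof (intro allI impI notI)
    fix U assume "clash r k ?H U"
    then obtain K g where K: "K \<in> cliques r k ?H" and g: "g \<in> edges ?H" "g \<inter> K \<noteq> {}" "\<not> g \<subseteq> K"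
      unfolding clash_def by blast
    obtain j where j: "K = block k j" using cliques_clique_union[OF r K] by blast
    obtain i where i: "g \<subseteq> block k i" using g by (auto simp: clique_union_def)
    have "i = j" using g(2) i j r by (auto simp: mem_block disjoint_iff subset_iff)
    then show False using g i j by blast
  qed
  fix e assume "e \<subseteq> verts ?H \<and> card e = r \<and> e \<notin> edges ?H"
  then have e: "e \<subseteq> {..<m * k}" "card e = r" "\<And>j. j < m \<Longrightarrow> \<not> e \<subseteq> block k j"
    by (auto simp: clique_union_def)
  have fine: "finite e" using e finite_subset by blast
  have lt: "x div k < m" if "x \<in> e" for x using that e by (auto simp: less_mult_imp_div_less)
  have K: "block k (x div k) \<in> cliques r k (add_edge e ?H)" if "x \<in> e" for x
    using lt[OF that] block_subset[OF lt[OF that]]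
    by (auto simp: cliques_def add_edge_def clique_union_def)
  have self: "x \<in> block k (x div k)" for x using r by (simp add: mem_block)
  define U where "U = (\<Union>x\<in>e. block k (x div k))"
  have "card U \<le> (\<Sum>x\<in>e. card (block k (x div k)))" unfolding U_def by (rule card_UN_le[OF fine])
  then have cU: "card U \<le> r * k" using e by simp
  obtain x where x: "x \<in> e" using e r by fastforce
  have "clash r k (add_edge e ?H) U"
    unfolding clash_def
  proof (intro conjI)
    show "U \<subseteq> verts (add_edge e ?H)" using K by (auto simp: U_def cliques_def)
    show "\<forall>x\<in>U. \<exists>K\<in>cliques r k (add_edge e ?H). K \<subseteq> U \<and> x \<in> K"
      using K unfolding U_def by blast
    have "e \<subseteq> U" using self by (auto simp: U_def)
    moreover have "block k (x div k) \<subseteq> U" using x by (auto simp: U_def)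
    moreover have "e \<in> edges (add_edge e ?H)" by (simp add: add_edge_def)
    ultimately show "\<exists>K\<in>cliques r k (add_edge e ?H). \<exists>g\<in>edges (add_edge e ?H).
        K \<subseteq> U \<and> g \<subseteq> U \<and> g \<inter> K \<noteq> {} \<and> \<not> g \<subseteq> K"
      using K[OF x] self[of x] x e(3)[OF lt[OF x]]
      by (intro bexI[of _ "block k (x div k)"] bexI[of _ e]) auto
  qed
  then show "\<not> clash_free r k (add_edge e ?H)" using cU by (auto simp: clash_free_def)
qed

lemma card_edges_clique_union: "card (edges (clique_union r k m)) \<le> m * (k choose r)"
proof -
  have "edges (clique_union r k m) = (\<Union>j<m. {g. g \<subseteq> block k j \<and> card g = r})"
    by (auto simp: clique_union_def)
  then have "card (edges (clique_union r k m)) \<le> (\<Sum>j<m. card {g. g \<subseteq> block k j \<and> card g = r})"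
    by (simp add: card_UN_le)
  then show ?thesis by (simp add: n_subsets)
qed

section \<open>Bounds for the saturation number\<close>

lemma sat_number_le:
  "saturated r \<F> (H :: nat hgraph) \<Longrightarrow> card (verts H) = n \<Longrightarrow> sat_number r \<F> n \<le> card (edges H)"
  unfolding sat_number_def by (rule cInf_lower) blast+

lemma sat_number_multiple:
  assumes "2 \<le> r" "r \<le> k"
  shows "sat_number r (clash_family r k) (m * k) \<le> m * (k choose r)"
  using sat_number_le[OF saturated_clique_union[OF assms]] card_edges_clique_union[of r k m]
  by (fastforce simp: clique_union_def intro: order_trans)

text \<open>
  Members of the family have an edge, so the edgeless graph is a starting point, and any
  inclusion-maximal clash-free edge set is saturated. In particular the infimum defining the
  saturation number is never that of the empty set.
\<close>

lemma saturated_exists: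
  "\<exists>H :: nat hgraph. card (verts H) = n \<and> saturated r (clash_family r k) H"
proof -
  define \<E> where "\<E> = {E. r_graph r ({..<n}, E) \<and> clash_free r k ({..<n}, E)}"
  have "finite \<E>"
    by (rule finite_subset[of _ "Pow (Pow {..<n})"]) (auto simp: \<E>_def r_graph_def)
  moreover have "{} \<in> \<E>" by (auto simp: \<E>_def r_graph_def clash_free_def clash_def)
  ultimately obtain E where E: "E \<in> \<E>" "\<And>D. D \<in> \<E> \<Longrightarrow> E \<subseteq> D \<Longrightarrow> D = E"
    using finite_has_maximal[of \<E>] by blast
  have "saturated r (clash_family r k) ({..<n}, E)"
    unfolding saturated_iff
  proof (intro conjI allI impI notI)
    show "r_graph r ({..<n}, E)" "clash_free r k ({..<n}, E)" using E by (auto simp: \<E>_def)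
    fix e assume e: "e \<subseteq> verts ({..<n}, E) \<and> card e = r \<and> e \<notin> edges ({..<n}, E)"
      and free: "clash_free r k (add_edge e ({..<n}, E))"
    have "insert e E \<in> \<E>"
      using e E free by (auto simp: \<E>_def r_graph_def add_edge_def)
    then show False using E(2)[of "insert e E"] e by auto
  qed
  then show ?thesis by (metis card_lessThan fst_conv)
qed

lemma sat_number_attained:
  obtains H :: "nat hgraph" where "card (verts H) = n" "saturated r (clash_family r k) H"
    "card (edges H) = sat_number r (clash_family r k) n"
proof -
  have "sat_number r (clash_family r k) n \<in>
      {card (edges H) | H :: nat hgraph. card (verts H) = n \<and> saturated r (clash_family r k) H}"
    unfolding sat_number_def by (rule Inf_nat_def1) (use saturated_exists[of n r k] in auto)
  then show ?thesis using that by auto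
qed

lemma sat_number_nonmultiple:
  assumes r: "2 \<le> r" "r < k" and n: "r \<le> n" "\<not> k dvd n"
  shows "real n ^ (r - 1) / (real (r - 1) ^ (r - 1) * real r) \<le> real (sat_number r (clash_family r k) n)"
proof -
  obtain H :: "nat hgraph" where H: "card (verts H) = n" "saturated r (clash_family r k) H"
    "card (edges H) = sat_number r (clash_family r k) n" by (rule sat_number_attained)
  have "(real n / real (r - 1)) ^ (r - 1) \<le> real (n choose (r - 1))"
    using binomial_ge_n_over_k_pow_k[of "r - 1" n, where ?'a = real] n by simp
  also have "\<dots> \<le> real (r * sat_number r (clash_family r k) n)"
    using card_edges_lower[OF H(2) r] H n by (metis of_nat_le_iff)
  finally show ?thesis using r by (simp add: field_simps power_divide)
qed


section \<open>Sharper bounds for graphs\<close>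

lemma pair_clique:
  assumes "K \<in> cliques 2 k H" "x \<in> K" "y \<in> K" "x \<noteq> y"
  shows "{x, y} \<in> edges H"
  using assms by (auto simp: cliques_def)

text \<open>
  A clique vertex has degree at least \<open>k - 1\<close>; if its degree is less than \<open>k\<close>, all its edges lie
  inside the clique.
\<close>

lemma card_edges_at_clique_vertex:
  assumes H: "r_graph 2 H" and K: "K \<in> cliques 2 k H" "u \<in> K"
  shows "k - 1 \<le> card {g \<in> edges H. u \<in> g}"
    and "card {g \<in> edges H. u \<in> g} < k \<Longrightarrow> g \<in> edges H \<Longrightarrow> u \<in> g \<Longrightarrow> g \<subseteq> K"
proof -
  let ?S = "(\<lambda>w. {u, w}) ` (K - {u})"
  have fin: "finite {g \<in> edges H. u \<in> g}" using finite_edges[OF H] by simp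
  have "inj_on (\<lambda>w. {u, w}) (K - {u})" by (auto simp: inj_on_def doubleton_eq_iff)
  then have cS: "card ?S = k - 1" using K by (simp add: card_image cliques_def)
  have sub: "?S \<subseteq> {g \<in> edges H. u \<in> g}" using pair_clique[OF K] by blast
  show le: "k - 1 \<le> card {g \<in> edges H. u \<in> g}" using card_mono[OF fin sub] cS by simp
  show "g \<subseteq> K" if "card {g \<in> edges H. u \<in> g} < k" "g \<in> edges H" "u \<in> g"
  proof -
    have "?S = {g \<in> edges H. u \<in> g}" using card_subset_eq[OF fin sub] le cS that(1) by simp
    then have "g \<in> ?S" using that by blast
    then show ?thesis using K by blast
  qed
qed

lemma graph_common_neighbours:
  assumes sat: "saturated 2 (clash_family 2 k) H"
    and v: "v \<in> verts H" "v \<notin> \<Union> (cliques 2 k H)"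
    and u: "u \<in> verts H" "u \<noteq> v" "{v, u} \<notin> edges H"
  obtains W where "card W = k - 2" "u \<notin> W" "v \<notin> W"
    "\<And>w. w \<in> W \<Longrightarrow> {v, w} \<in> edges H \<and> {u, w} \<in> edges H"
proof -
  obtain K where K: "K \<in> cliques 2 k (add_edge {v, u} H)" "{v, u} \<subseteq> K"
    using completes_clique[OF sat v(2), of "{v, u}"] u v by auto
  show ?thesis
  proof (rule that[of "K - {v, u}"])
    show "card (K - {v, u}) = k - 2"
      using K u by (subst card_Diff_subset) (auto simp: cliques_def)
    fix w assume w: "w \<in> K - {v, u}"
    have "{v, w} \<in> edges (add_edge {v, u} H)" "{u, w} \<in> edges (add_edge {v, u} H)"
      using pair_clique[OF K(1)] K w by auto
    then show "{v, w} \<in> edges H \<and> {u, w} \<in> edges H"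
      using w by (auto simp: add_edge_def doubleton_eq_iff)
  qed auto
qed

text \<open>
  Each vertex \<open>u\<close> outside the closed neighbourhood of \<open>v\<close> sends \<open>k - 2\<close> edges into the open
  neighbourhood \<open>N\<close>, and edges from distinct such vertices into \<open>N\<close> are distinct.
\<close>

lemma graph_edges_lower_small_degree:
  assumes sat: "saturated 2 (clash_family 2 k) H"
    and v: "v \<in> verts H" "v \<notin> \<Union> (cliques 2 k H)"
    and deg: "card {g \<in> edges H. v \<in> g} < k"
  shows "(k - 2) * (card (verts H) - k) \<le> card (edges H)"
proof -
  have H: "r_graph 2 H" using sat by (simp add: saturated_def)
  have fin: "finite (verts H)" and edge: "\<And>g. g \<in> edges H \<Longrightarrow> g \<subseteq> verts H \<and> card g = 2"
    using H by (auto simp: r_graph_def)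
  have finE: "finite (edges H)" by (rule finite_edges[OF H])
  define N where "N = {w. {v, w} \<in> edges H}"
  have NV: "N \<subseteq> verts H" using edge by (auto simp: N_def)
  have vN: "v \<notin> N" using edge[of "{v}"] by (auto simp: N_def)
  have "card N \<le> card {g \<in> edges H. v \<in> g}"
    by (rule card_inj_on_le[of "\<lambda>w. {v, w}"])
      (use finE in \<open>auto simp: N_def inj_on_def doubleton_eq_iff\<close>)
  then have cN: "card (insert v N) \<le> k"
    using deg vN finite_subset[OF NV fin] by simp
  define M where "M = verts H - insert v N"
  have "card M = card (verts H) - card (insert v N)"
    unfolding M_def using NV v fin by (intro card_Diff_subset) (auto intro: finite_subset)
  then have cM: "card (verts H) - k \<le> card M" using cN by simp
  define F where "F = (\<lambda>u. {g \<in> edges H. u \<in> g \<and> g \<inter> N \<noteq> {}})"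
  have cF: "k - 2 \<le> card (F u)" if u: "u \<in> M" for u
  proof -
    have u': "u \<in> verts H" "u \<noteq> v" "{v, u} \<notin> edges H" using u by (auto simp: M_def N_def)
    obtain W where W: "card W = k - 2" "u \<notin> W" "v \<notin> W"
        "\<And>w. w \<in> W \<Longrightarrow> {v, w} \<in> edges H \<and> {u, w} \<in> edges H"
      using graph_common_neighbours[OF sat v u'] by blast
    have "card W \<le> card (F u)"
      by (rule card_inj_on_le[of "\<lambda>w. {u, w}"])
        (use finE W in \<open>auto simp: F_def N_def inj_on_def doubleton_eq_iff\<close>)
    then show ?thesis using W by simp
  qed
  have disj: "F u \<inter> F u' = {}" if "u \<in> M" "u' \<in> M" "u \<noteq> u'" for u u'
  proof (rule ccontr)
    assume "F u \<inter> F u' \<noteq> {}"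
    then obtain g where g: "g \<in> edges H" "u \<in> g" "u' \<in> g" "g \<inter> N \<noteq> {}" by (auto simp: F_def)
    have "g = {u, u'}" using edge[OF g(1)] g that by (auto simp: card_2_iff)
    then show False using g that by (auto simp: M_def)
  qed
  have "(k - 2) * (card (verts H) - k) \<le> (\<Sum>u\<in>M. k - 2)" using cM by simp
  also have "\<dots> \<le> (\<Sum>u\<in>M. card (F u))" by (rule sum_mono[OF cF])
  also have "\<dots> = card (\<Union>u\<in>M. F u)"
    using fin finE disj by (intro card_UN_disjoint[symmetric]) (auto simp: M_def F_def)
  also have "\<dots> \<le> card (edges H)" by (rule card_mono[OF finE]) (auto simp: F_def)
  finally show ?thesis .
qed

text \<open>
  Let \<open>P\<close> be the set of vertices of degree at least \<open>k\<close>. It meets every \<open>k\<close>-clique \<open>K\<close>: otherwise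
  no edge leaves \<open>K\<close>, and a vertex outside all cliques has no common neighbour with a vertex of \<open>K\<close>,
  whereas saturation provides \<open>k - 2\<close> of them.
  Every vertex is in \<open>P\<close> or in a clique, and cliques are disjoint, so \<open>P\<close> contains at least one \<open>k\<close>-th
  of the vertices. Summing the degrees gives the bound.
\<close>

lemma graph_edges_lower_large_degree:
  assumes sat: "saturated 2 (clash_family 2 k) H" and k: "3 \<le> k"
    and n: "\<not> k dvd card (verts H)"
    and deg: "\<And>v. v \<in> verts H \<Longrightarrow> v \<notin> \<Union> (cliques 2 k H) \<Longrightarrow> k \<le> card {g \<in> edges H. v \<in> g}"
  shows "(k * (k - 1) + 1) * card (verts H) \<le> 2 * k * card (edges H)"
proof -
  have H: "r_graph 2 H" and free: "clash_free 2 k H"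
    using sat by (auto simp: saturated_iff)
  have fin: "finite (verts H)" and edge: "\<And>g. g \<in> edges H \<Longrightarrow> g \<subseteq> verts H \<and> card g = 2"
    using H by (auto simp: r_graph_def)
  have finE: "finite (edges H)" by (rule finite_edges[OF H])
  obtain v where v: "v \<in> verts H" "v \<notin> \<Union> (cliques 2 k H)"
    using uncovered_vertex[OF sat] k n by auto
  define d where "d = (\<lambda>u. card {g \<in> edges H. u \<in> g})"
  define P where "P = {u \<in> verts H. k \<le> d u}"
  have finP: "finite P" using fin by (simp add: P_def)
  have meet: "\<exists>w\<in>K. w \<in> P" if K: "K \<in> cliques 2 k H" for K
  proof (rule ccontr)
    assume "\<not> ?thesis"
    then have low: "card {g \<in> edges H. w \<in> g} < k" if "w \<in> K" for w
      using K that by (auto simp: P_def d_def cliques_def)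
    have inK: "g \<subseteq> K" if "g \<in> edges H" "w \<in> g" "w \<in> K" for g w
      using card_edges_at_clique_vertex(2)[OF H K] low that by blast
    have vK: "v \<notin> K" using v K by blast
    have "K \<noteq> {}" using K k by (auto simp: cliques_def)
    then obtain u where u: "u \<in> K" by blast
    have u': "u \<in> verts H" "u \<noteq> v" "{v, u} \<notin> edges H"
      using u vK K inK[of "{v, u}" u] by (auto simp: cliques_def)
    obtain W where W: "card W = k - 2" "\<And>w. w \<in> W \<Longrightarrow> {v, w} \<in> edges H \<and> {u, w} \<in> edges H"
      using graph_common_neighbours[OF sat v u'] by blast
    have "W \<noteq> {}" using W k by auto
    then obtain w where w: "w \<in> W" by blast
    have "w \<in> K" using inK[of "{u, w}" u] W(2)[OF w] u by blast
    then show False using inK[of "{v, w}" w] W(2)[OF w] vK by blast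
  qed
  \<comment> \<open>\<open>Q w\<close> is the clique through \<open>w\<close>, or \<open>{w}\<close> if there is none.\<close>
  define Q where "Q = (\<lambda>w. insert w (\<Union> {K \<in> cliques 2 k H. w \<in> K}))"
  have cQ: "card (Q w) \<le> k" for w
  proof (cases "\<exists>K\<in>cliques 2 k H. w \<in> K")
    case True
    then obtain K where K: "K \<in> cliques 2 k H" "w \<in> K" by blast
    have "L = K" if "L \<in> cliques 2 k H" "w \<in> L" for L
      using clique_unique[OF H free _ _ that(1) K(1) that(2) K(2)] k by simp
    then have "Q w = K" unfolding Q_def using K by blast
    then show ?thesis using K by (simp add: cliques_def)
  next
    case False
    then have "Q w = {w}" by (auto simp: Q_def)
    then show ?thesis using k by simp
  qed
  have VQ: "verts H \<subseteq> (\<Union>w\<in>P. Q w)"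
  proof
    fix u assume u: "u \<in> verts H"
    show "u \<in> (\<Union>w\<in>P. Q w)"
    proof (cases "u \<in> P")
      case False
      then obtain K where K: "K \<in> cliques 2 k H" "u \<in> K" using deg[OF u] u by (auto simp: P_def d_def)
      then obtain w where "w \<in> K" "w \<in> P" using meet by blast
      then show ?thesis using K by (auto simp: Q_def)
    qed (auto simp: Q_def)
  qed
  have "card (verts H) \<le> card (\<Union>w\<in>P. Q w)"
  proof (rule card_mono[OF _ VQ])
    have "Q w \<subseteq> verts H" if "w \<in> P" for w using that by (auto simp: Q_def P_def cliques_def)
    then show "finite (\<Union>w\<in>P. Q w)" using fin finP by (auto intro: finite_subset)
  qed
  also have "\<dots> \<le> (\<Sum>w\<in>P. card (Q w))" by (rule card_UN_le[OF finP])
  also have "\<dots> \<le> (\<Sum>w\<in>P. k)" by (rule sum_mono[OF cQ])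
  finally have nP: "card (verts H) \<le> k * card P" by (simp add: mult.commute)
  have dlow: "(k - 1) + (if u \<in> P then 1 else 0) \<le> d u" if u: "u \<in> verts H" for u
  proof (cases "u \<in> P")
    case True
    then show ?thesis using k by (simp add: P_def)
  next
    case False
    then obtain K where K: "K \<in> cliques 2 k H" "u \<in> K" using deg[OF u] u by (auto simp: P_def d_def)
    then show ?thesis using card_edges_at_clique_vertex(1)[OF H K] False by (simp add: d_def)
  qed
  have "(k - 1) * card (verts H) + card P = (\<Sum>u\<in>verts H. (k - 1) + (if u \<in> P then 1 else 0))"
  proof -
    have "(\<Sum>u\<in>verts H. if u \<in> P then 1 else 0) = card (verts H \<inter> P)"
      using fin by (simp add: sum.If_cases)
    moreover have "verts H \<inter> P = P" by (auto simp: P_def)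
    ultimately show ?thesis by (simp add: sum.distrib mult.commute)
  qed
  also have "\<dots> \<le> (\<Sum>u\<in>verts H. d u)" by (rule sum_mono[OF dlow])
  also have "\<dots> = 2 * card (edges H)"
    unfolding d_def
  proof (rule sum_multicount[OF fin finE], rule ballI)
    fix g assume "g \<in> edges H"
    then have "{u \<in> verts H. u \<in> g} = g" "card g = 2" using edge by auto
    then show "card {u \<in> verts H. u \<in> g} = 2" by simp
  qed
  finally have "k * ((k - 1) * card (verts H) + card P) \<le> k * (2 * card (edges H))" by simp
  then show ?thesis using nP by (simp add: algebra_simps)
qed

lemma sat_number_graph_nonmultiple:
  assumes k: "3 \<le> k" and n: "\<not> k dvd n"
  shows "(k * (k - 1) + 1) * n \<le> 2 * k * sat_number 2 (clash_family 2 k) n \<or>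
    (k - 2) * (n - k) \<le> sat_number 2 (clash_family 2 k) n"
proof -
  obtain H :: "nat hgraph" where H: "card (verts H) = n" "saturated 2 (clash_family 2 k) H"
    "card (edges H) = sat_number 2 (clash_family 2 k) n" by (rule sat_number_attained)
  show ?thesis
    using graph_edges_lower_small_degree[OF H(2)] graph_edges_lower_large_degree[OF H(2) k] n
    unfolding H(1,3) by (meson not_le)
qed


section \<open>Growth and non-convergence\<close>

lemma not_convergent_if_residue_gap:
  fixes X :: "nat \<Rightarrow> real"
  assumes "0 < k" "a < b"
    and le: "\<forall>\<^sub>F m in sequentially. X (m * k) \<le> a"
    and ge: "\<forall>\<^sub>F m in sequentially. b \<le> X (m * k + 1)"
  shows "\<not> convergent X"
proof
  assume "convergent X"
  then obtain L where L: "X \<longlonglongrightarrow> L" by (auto simp: convergent_def)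
  have "strict_mono (\<lambda>m. m * k)" "strict_mono (\<lambda>m. m * k + 1)"
    using \<open>0 < k\<close> by (auto simp: strict_mono_def)
  then have "(\<lambda>m. X (m * k)) \<longlonglongrightarrow> L" "(\<lambda>m. X (m * k + 1)) \<longlonglongrightarrow> L"
    using LIMSEQ_subseq_LIMSEQ[OF L] by (auto simp: o_def)
  then have "L \<le> a" "b \<le> L"
    using tendsto_upperbound[OF _ le] tendsto_lowerbound[OF _ ge] by auto
  then show False using \<open>a < b\<close> by simp
qed

lemma eventually_real_ge_and_pos: "\<forall>\<^sub>F m in sequentially. a \<le> real m \<and> 1 \<le> m"
  using filterlim_real_sequentially
  by (intro eventually_conj eventually_ge_at_top) (simp add: filterlim_at_top)

lemma real_le_mult_pos: "0 < k \<Longrightarrow> real m \<le> real (m * k)"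
  by (cases k) (simp_all del: of_nat_mult)

lemma not_dvd_mult_plus_1: "2 \<le> (k::nat) \<Longrightarrow> \<not> k dvd m * k + 1"
  using dvd_add_right_iff[of k "m * k" 1] by simp

text \<open>The quotients are at most \<open>3 / 2\<close> along multiples of \<open>4\<close> and at least \<open>13 / 8\<close> at other large \<open>n\<close>.\<close>

lemma not_convergent_graph:
  fixes s :: "nat \<Rightarrow> real"
  assumes upper: "\<And>m. s (m * 4) \<le> 6 * real m"
    and lower: "\<And>n. 22 \<le> n \<Longrightarrow> \<not> 4 dvd n \<Longrightarrow> 13 * real n \<le> 8 * s n"
  shows "\<not> convergent (\<lambda>n. s n / real n)"
proof (rule not_convergent_if_residue_gap[of 4 "3 / 2" "13 / 8"])
  show "\<forall>\<^sub>F m in sequentially. s (m * 4) / real (m * 4) \<le> 3 / 2"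
  proof (intro always_eventually allI)
    fix m
    show "s (m * 4) / real (m * 4) \<le> 3 / 2"
      using upper[of m] by (cases "m = 0") (simp_all add: field_simps)
  qed
  show "\<forall>\<^sub>F m in sequentially. 13 / 8 \<le> s (m * 4 + 1) / real (m * 4 + 1)"
  proof (rule eventually_mono[OF eventually_ge_at_top[of "6 :: nat"]])
    fix m :: nat assume m: "6 \<le> m"
    define n where "n = m * 4 + 1"
    have n: "22 \<le> n" "\<not> 4 dvd n" using m not_dvd_mult_plus_1[of 4 m] by (simp_all add: n_def)
    have "13 / 8 \<le> s n / real n" using lower[OF n] n(1) by (simp add: field_simps)
    then show "13 / 8 \<le> s (m * 4 + 1) / real (m * 4 + 1)" by (simp add: n_def)
  qed
qed simp_all

text \<open>The quotients tend to \<open>0\<close> along multiples of \<open>k\<close> and are at least \<open>c\<close> at all other \<open>n \<ge> k\<close>.\<close>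

lemma not_convergent_exponent_ge_2:
  fixes s :: "nat \<Rightarrow> real"
  assumes k: "2 \<le> k" and c: "0 < c" and C: "0 \<le> C" and l: "2 \<le> l" "l \<le> d"
    and upper: "\<And>m. s (m * k) \<le> C * real m"
    and lower: "\<And>n. k \<le> n \<Longrightarrow> \<not> k dvd n \<Longrightarrow> c * real n ^ d \<le> s n"
  shows "\<not> convergent (\<lambda>n. s n / real n ^ l)"
proof (rule not_convergent_if_residue_gap[of k "c / 2" c])
  show "\<forall>\<^sub>F m in sequentially. s (m * k) / real (m * k) ^ l \<le> c / 2"
  proof (rule eventually_mono[OF eventually_real_ge_and_pos[of "2 * C / c"]])
    fix m assume m: "2 * C / c \<le> real m \<and> 1 \<le> m"
    have le: "real m \<le> real (m * k)" using k by (intro real_le_mult_pos) simp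
    have "real m ^ 2 \<le> real (m * k) ^ 2" by (rule power_mono[OF le]) simp
    also have "\<dots> \<le> real (m * k) ^ l"
      using m le l by (intro power_increasing) linarith+
    finally have "s (m * k) / real (m * k) ^ l \<le> C * real m / real m ^ 2"
      using upper[of m] m C by (intro frac_le) auto
    also have "\<dots> = C / real m" using m by (simp add: power2_eq_square)
    also have "\<dots> \<le> c / 2" using m c by (simp add: field_simps)
    finally show "s (m * k) / real (m * k) ^ l \<le> c / 2" .
  qed
  show "\<forall>\<^sub>F m in sequentially. c \<le> s (m * k + 1) / real (m * k + 1) ^ l"
  proof (rule eventually_mono[OF eventually_ge_at_top[of "1 :: nat"]])
    fix m :: nat assume m: "1 \<le> m"
    define n where "n = m * k + 1"
    have "1 * k \<le> m * k" using m by (intro mult_le_mono1)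
    then have n: "k \<le> n" "1 \<le> n" unfolding n_def by linarith+
    have "c * real n ^ l \<le> c * real n ^ d"
      using n l c by (intro mult_left_mono power_increasing) auto
    also have "\<dots> \<le> s n" using lower[OF n(1)] not_dvd_mult_plus_1[OF k, of m] by (simp add: n_def)
    finally have "c \<le> s n / real n ^ l" using n by (simp add: field_simps)
    then show "c \<le> s (m * k + 1) / real (m * k + 1) ^ l" by (simp add: n_def)
  qed
qed (use k c in simp_all)

text \<open>The quotients are bounded along multiples of \<open>k\<close> and unbounded along the residue class of \<open>1\<close>.\<close>

lemma not_convergent_exponent_1:
  fixes s :: "nat \<Rightarrow> real"
  assumes k: "2 \<le> k" and c: "0 < c" and C: "0 \<le> C" and d: "2 \<le> d"
    and upper: "\<And>m. s (m * k) \<le> C * real m"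
    and lower: "\<And>n. k \<le> n \<Longrightarrow> \<not> k dvd n \<Longrightarrow> c * real n ^ d \<le> s n"
  shows "\<not> convergent (\<lambda>n. s n / real n)"
proof (rule not_convergent_if_residue_gap[of k C "C + 1"])
  have le: "real m \<le> real (m * k)" for m using k by (intro real_le_mult_pos) simp
  show "\<forall>\<^sub>F m in sequentially. s (m * k) / real (m * k) \<le> C"
  proof (intro always_eventually allI)
    fix m
    have "C * real m \<le> C * real (m * k)" by (rule mult_left_mono[OF le C])
    then have "s (m * k) \<le> C * real (m * k)" using upper[of m] by linarith
    then show "s (m * k) / real (m * k) \<le> C"
      using C by (cases "m * k = 0") (auto simp: pos_divide_le_eq simp del: of_nat_mult)
  qed
  show "\<forall>\<^sub>F m in sequentially. C + 1 \<le> s (m * k + 1) / real (m * k + 1)"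
  proof (rule eventually_mono[OF eventually_real_ge_and_pos[of "(C + 1) / c"]])
    fix m assume m: "(C + 1) / c \<le> real m \<and> 1 \<le> m"
    define n where "n = m * k + 1"
    have "1 * k \<le> m * k" using m by (intro mult_le_mono1) simp
    moreover have "m \<le> m * k" using le[of m] by linarith
    ultimately have n: "k \<le> n" "1 \<le> n" "m \<le> n" unfolding n_def by linarith+
    have "C + 1 \<le> c * real m" using m c by (simp add: field_simps)
    also have "\<dots> \<le> c * real n" using n c by simp
    finally have "(C + 1) * real n \<le> c * real n * real n" by (rule mult_right_mono) simp
    also have "\<dots> = c * real n ^ 2" by (simp add: power2_eq_square)
    also have "\<dots> \<le> c * real n ^ d"
      using n d c by (intro mult_left_mono power_increasing) auto
    also have "\<dots> \<le> s n" using lower[OF n(1)] not_dvd_mult_plus_1[OF k, of m] by (simp add: n_def)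
    finally have "C + 1 \<le> s n / real n" using n by (simp add: pos_le_divide_eq)
    then show "C + 1 \<le> s (m * k + 1) / real (m * k + 1)" by (simp add: n_def)
  qed
qed (use k in simp_all)

lemma sat_number_multiple_real:
  assumes "2 \<le> r" "r \<le> k"
  shows "real (sat_number r (clash_family r k) (m * k)) \<le> real (k choose r) * real m"
  using of_nat_mono[OF sat_number_multiple[OF assms, of m], where ?'a = real]
  by (simp add: mult.commute)

lemma sat_number_bigo_multiples:
  assumes r: "2 \<le> r" "r \<le> k"
  shows "(\<lambda>n. real (sat_number r (clash_family r k) n))
    \<in> O[inf at_top (principal {n. k dvd n})](\<lambda>n. real n)"
proof (rule bigoI[of _ "real (k choose r)"])
  show "\<forall>\<^sub>F n in inf at_top (principal {n. k dvd n}).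
      norm (real (sat_number r (clash_family r k) n)) \<le> real (k choose r) * norm (real n)"
    unfolding eventually_inf_principal
  proof (intro always_eventually allI impI)
    fix n assume "n \<in> {n. k dvd n}"
    then obtain m where m: "n = m * k" by (auto simp: dvd_def mult.commute)
    have "real m \<le> real n" unfolding m using r by (intro real_le_mult_pos) simp
    then have "real (k choose r) * real m \<le> real (k choose r) * real n"
      by (rule mult_left_mono) simp
    then show "norm (real (sat_number r (clash_family r k) n)) \<le> real (k choose r) * norm (real n)"
      using sat_number_multiple_real[OF r, of m] unfolding m by simp
  qed
qed

lemma sat_number_bigomega_nonmultiples:
  assumes r: "2 \<le> r" "r < k"
  shows "(\<lambda>n. real (sat_number r (clash_family r k) n))
    \<in> \<Omega>[inf at_top (principal {n. \<not> k dvd n})](\<lambda>n. real n ^ (r - 1))"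
proof (rule landau_omega.bigI)
  show "0 < 1 / (real (r - 1) ^ (r - 1) * real r)" using r by simp
  show "\<forall>\<^sub>F n in inf at_top (principal {n. \<not> k dvd n}).
      1 / (real (r - 1) ^ (r - 1) * real r) * norm (real n ^ (r - 1))
      \<le> norm (real (sat_number r (clash_family r k) n))"
    unfolding eventually_inf_principal
    by (rule eventually_mono[OF eventually_ge_at_top[of r]]) (use sat_number_nonmultiple[OF r] in auto)
qed

lemma sat_number_graph_not_convergent:
  "\<not> convergent (\<lambda>n. real (sat_number 2 (clash_family 2 4) n) / real n)"
proof (rule not_convergent_graph)
  have "real (4 choose 2) = 6" by (simp add: numeral_eq_Suc)
  then show "real (sat_number 2 (clash_family 2 4) (m * 4)) \<le> 6 * real m" for m
    using sat_number_multiple_real[of 2 4 m] by simp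
  \<comment> \<open>The bound \<open>2 * (n - 4)\<close> is at least \<open>(13 / 8) * n\<close> from \<open>n = 22\<close> on.\<close>
  show "13 * real n \<le> 8 * real (sat_number 2 (clash_family 2 4) n)" if n: "22 \<le> n" "\<not> 4 dvd n" for n
  proof -
    have "13 * n \<le> 8 * sat_number 2 (clash_family 2 4) n"
      using sat_number_graph_nonmultiple[of 4 n] n by auto
    then show ?thesis by linarith
  qed
qed

lemma sat_number_not_convergent:
  assumes r: "3 \<le> r" "r < k" and l: "1 \<le> l" "l \<le> r - 1"
  shows "\<not> convergent (\<lambda>n. real (sat_number r (clash_family r k) n) / real n ^ l)"
proof -
  define s where "s = (\<lambda>n. real (sat_number r (clash_family r k) n))"
  define c where "c = 1 / (real (r - 1) ^ (r - 1) * real r)"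
  have r2: "2 \<le> r" "r \<le> k" "2 \<le> k" "2 \<le> r - 1" using r by simp_all
  have c: "0 < c" using r by (simp add: c_def)
  have upper: "s (m * k) \<le> real (k choose r) * real m" for m
    unfolding s_def by (rule sat_number_multiple_real[OF r2(1,2)])
  have lower: "c * real n ^ (r - 1) \<le> s n" if "k \<le> n" "\<not> k dvd n" for n
    using sat_number_nonmultiple[OF r2(1) r(2), of n] that r2(2) by (simp add: s_def c_def)
  have "\<not> convergent (\<lambda>n. s n / real n ^ l)"
  proof (cases "l = 1")
    case True
    have "\<not> convergent (\<lambda>n. s n / real n)"
      by (rule not_convergent_exponent_1[OF r2(3) c of_nat_0_le_iff r2(4) upper lower])
    then show ?thesis using True by simp
  next
    case False
    then have "2 \<le> l" using l by simp
    then show ?thesis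
      by (rule not_convergent_exponent_ge_2[OF r2(3) c of_nat_0_le_iff _ l(2) upper lower])
  qed
  then show ?thesis unfolding s_def .
qed

theorem theorem3:
  fixes r :: nat
  assumes "r \<ge> 2"
  shows "\<exists>(\<F> :: nat hgraph set) (k :: nat).
    finite \<F> \<and> (\<forall>G\<in>\<F>. r_graph r G) \<and> k \<ge> 2 \<and>
    (\<lambda>n. real (sat_number r \<F> n)) \<in> O[inf at_top (principal {n. k dvd n})](\<lambda>n. real n) \<and>
    (\<lambda>n. real (sat_number r \<F> n)) \<in> \<Omega>[inf at_top (principal {n. \<not> k dvd n})](\<lambda>n. real n ^ (r - 1)) \<and>
    (\<forall>l\<in>{1..r - 1}. \<not> convergent (\<lambda>n. real (sat_number r \<F> n) / real n ^ l))"
proof -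
  \<comment> \<open>\<open>k = r + 1\<close> would do for \<open>r \<ge> 3\<close>; for \<open>r = 2\<close> the lower bound
    \<open>(k - 2) * (n - k)\<close> has to exceed \<open>(k - 1) / 2 * n\<close> for large \<open>n\<close>, hence \<open>k \<ge> 4\<close>.\<close>
  define k where "k = r + 2"
  have k: "r < k" "r \<le> k" "2 \<le> k" by (simp_all add: k_def)
  have diverges: "\<not> convergent (\<lambda>n. real (sat_number r (clash_family r k) n) / real n ^ l)"
    if l: "l \<in> {1..r - 1}" for l
  proof (cases "r = 2")
    case True
    then have "l = 1" "k = 4" using l by (simp_all add: k_def)
    then show ?thesis using sat_number_graph_not_convergent True by simp
  next
    case False
    then show ?thesis using assms k(1) l by (intro sat_number_not_convergent) simp_all
  qed
  show ?thesis
  proof (intro exI conjI ballI)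
    show "finite (clash_family r k)" by (rule finite_clash_family)
    show "r_graph r G" if "G \<in> clash_family r k" for G using that by (simp add: clash_family_def)
    show "2 \<le> k" by (rule k(3))
  qed (rule sat_number_bigo_multiples[OF assms k(2)] sat_number_bigomega_nonmultiples[OF assms k(1)]
      diverges, assumption?)+
qed

end
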